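(* Let $n\le m$. (a) Let $f:(\mathbb{R}^n,a)\to(\mathbb{R}^m,b)$ be a frontal, let $\widetilde f$ be a Legendre lift of $f$, let $(x_1,\dots,x_m)$ be a system of local coordinates of $\mathbb{R}^m$ centered at $b$ adapted to $\widetilde f$, and set $f_i=x_i\circ f$. Then $f$ is, via these coordinates, an opening of $g:=(f_1,\dots,f_n):(\mathbb{R}^n,a)\to(\mathbb{R}^n,g(a))$. (b) Conversely, any opening $f:(\mathbb{R}^n,a)\to(\mathbb{R}^m,b)$ of a map-germ $g:(\mathbb{R}^n,a)\to(\mathbb{R}^n,g(a))$ is a frontal. (c) An opening of $g$ is a proper frontal if and only if $g$ is proper, i.e. $S(g)$ is nowhere dense in $(\mathbb{R}^n,a)$.
   Context: All maps and germs are $C^\infty$; $\mathcal{E}_a$ is the algebra of smooth function-germs on $(\mathbb{R}^n,a)$. A germ $f:(\mathbb{R}^n,a)\to(\mathbb{R}^m,b)$, $n\le m$, is a frontal if there is a smooth germ $\widetilde f:(\mathbb{R}^n,a)\to\mathrm{Gr}(n,T\mathbb{R}^m)$ (the bundle of $n$-planes in tangent spaces of $\mathbb{R}^m$) lifting $f$ with $T_tf(T_t\mathbb{R}^n)\subset\widetilde f(t)\subset T_{f(t)}\mathbb{R}^m$ for all $t$ near $a$; such $\widetilde f$ is a Legendre lift. The singular locus is $S(f)=\{t\mid\mathrm{rank}(T_tf)<n\}$. A frontal $f$ is proper if $S(f)$ is nowhere dense in $(\mathbb{R}^n,a)$. Local coordinates $(x_1,\dots,x_m)$ of $\mathbb{R}^m$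 centered at $b$ are adapted to $\widetilde f$ if $\widetilde f(a)=\langle(\partial/\partial x_1)_b,\dots,(\partial/\partial x_n)_b\rangle_{\mathbb R}$. For a map-germ $g=(g_1,\dots,g_n):(\mathbb{R}^n,a)\to(\mathbb{R}^n,g(a))$, the Jacobi module is $\mathcal{J}_g=\sum_{j}\mathcal{E}_a\,dg_j$, a submodule of the module of germs of $1$-forms on $(\mathbb{R}^n,a)$. A map-germ $f:(\mathbb{R}^n,a)\to(\mathbb{R}^m,b)$ is an opening of $g$ if, via a system of local coordinates of $(\mathbb{R}^m,b)$, $f$ has the form $(g_1,\dots,g_n,f_{n+1},\dots,f_m)$ with $df_j\in\mathcal{J}_g$ for $n+1\le j\le m$. *)

theory Defs
  imports "HOL-Analysis.Analysis"
begin

text \<open>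
  A map-germ at a point is represented by a total function of which only the values near the
  point matter; all the notions below depend only on the germ.
  The dimensions are n = CARD('n) and m = CARD('m). An injection \<open>\<iota> :: 'n \<Rightarrow> 'm\<close>
  singles out the coordinates called "the first n" of the m coordinates; it embodies n \<open>\<le>\<close> m.
\<close>

subsection \<open>Smooth germs\<close>

text \<open>\<open>Ck_on k U f\<close> is meant for open \<open>U\<close> and finite-dimensional domains: all iterated directional
  derivatives of order up to \<open>k\<close> exist and are continuous.\<close>

primrec Ck_on ::
  "nat \<Rightarrow> 'a::euclidean_space set \<Rightarrow> ('a \<Rightarrow> 'b::real_normed_vector) \<Rightarrow> bool" where
  "Ck_on 0 U f \<longleftrightarrow> continuous_on U f"
| "Ck_on (Suc k) U f \<longleftrightarrow> (\<forall>x\<in>U. f differentiable (at x)) \<and>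
     (\<forall>v. Ck_on k U (\<lambda>x. frechet_derivative f (at x) v))"

definition smooth_on :: "'a::euclidean_space set \<Rightarrow> ('a \<Rightarrow> 'b::real_normed_vector) \<Rightarrow> bool" where
  "smooth_on U f \<longleftrightarrow> (\<forall>k. Ck_on k U f)"

definition smooth_germ :: "'a::euclidean_space \<Rightarrow> ('a \<Rightarrow> 'b::real_normed_vector) \<Rightarrow> bool" where
  "smooth_germ a f \<longleftrightarrow> (\<exists>U. open U \<and> a \<in> U \<and> smooth_on U f)"

definition map_germ ::
  "'a::euclidean_space \<Rightarrow> 'b::real_normed_vector \<Rightarrow> ('a \<Rightarrow> 'b) \<Rightarrow> bool" where
  "map_germ a b f \<longleftrightarrow> smooth_germ a f \<and> f a = b"

subsection \<open>The Grassmann bundle\<close>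

definition grassmannian :: "nat \<Rightarrow> 'a::euclidean_space set set" where
  "grassmannian n = {W. subspace W \<and> dim W = n}"

text \<open>\<open>Gr(n, T\<real>\<^sup>m)\<close>, using the canonical trivialization of \<open>T\<real>\<^sup>m\<close>: a pair \<open>(y, W)\<close> is the
  \<open>n\<close>-plane \<open>W\<close> in the tangent space at \<open>y\<close>.\<close>

definition grassmann_bundle :: "nat \<Rightarrow> ('a::euclidean_space \<times> 'a set) set" where
  "grassmann_bundle n = UNIV \<times> grassmannian n"

text \<open>
  The standard atlas of the Grassmannian. The chart \<open>\<kappa>\<close> has as its domain the planes that
  project isomorphically onto the coordinates \<open>\<kappa> i\<close>. Such a plane is the column space of exactly
  one m-by-n matrix \<open>A\<close> whose submatrix of rows \<open>\<kappa> i\<close> is the identity, and the remaining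
  entries of \<open>A\<close> are the coordinates of the plane.
\<close>

definition grassmann_chart ::
  "('n::finite \<Rightarrow> 'm::finite) \<Rightarrow> (real^'m) set \<Rightarrow> real^'n^'m \<Rightarrow> bool" where
  "grassmann_chart \<kappa> W A \<longleftrightarrow> (\<forall>i. A $ \<kappa> i = axis i 1) \<and> W = range (\<lambda>v. A *v v)"

definition smooth_germ_grassmann_bundle ::
  "real^'n::finite \<Rightarrow> (real^'n \<Rightarrow> (real^'m::finite) \<times> (real^'m) set) \<Rightarrow> bool" where
  "smooth_germ_grassmann_bundle a F \<longleftrightarrow>
     (\<forall>\<^sub>F t in nhds a. F t \<in> grassmann_bundle CARD('n)) \<and>
     smooth_germ a (\<lambda>t. fst (F t)) \<and>
     (\<exists>(\<kappa> :: 'n \<Rightarrow> 'm) A. inj \<kappa> \<and> smooth_germ a A \<and>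
        (\<forall>\<^sub>F t in nhds a. grassmann_chart \<kappa> (snd (F t)) (A t)))"

subsection \<open>Frontals\<close>

definition legendre_lift ::
  "real^'n::finite \<Rightarrow> (real^'n \<Rightarrow> real^'m::finite) \<Rightarrow>
     (real^'n \<Rightarrow> (real^'m) \<times> (real^'m) set) \<Rightarrow> bool" where
  "legendre_lift a f F \<longleftrightarrow> smooth_germ_grassmann_bundle a F \<and>
     (\<forall>\<^sub>F t in nhds a. fst (F t) = f t \<and> range (frechet_derivative f (at t)) \<subseteq> snd (F t))"

definition frontal ::
  "real^'n::finite \<Rightarrow> real^'m::finite \<Rightarrow> (real^'n \<Rightarrow> real^'m) \<Rightarrow> bool" where
  "frontal a b f \<longleftrightarrow> map_germ a b f \<and> (\<exists>F. legendre_lift a f F)"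

definition singular_locus :: "(real^'n::finite \<Rightarrow> real^'m::finite) \<Rightarrow> (real^'n) set" where
  "singular_locus f = {t. rank (jacobian f (at t)) < CARD('n)}"

definition nowhere_dense_germ :: "'a::topological_space \<Rightarrow> 'a set \<Rightarrow> bool" where
  "nowhere_dense_germ a S \<longleftrightarrow>
     (\<exists>U. open U \<and> a \<in> U \<and> interior (closure (S \<inter> U)) = {})"

definition proper_germ ::
  "real^'n::finite \<Rightarrow> (real^'n \<Rightarrow> real^'m::finite) \<Rightarrow> bool" where
  "proper_germ a f \<longleftrightarrow> nowhere_dense_germ a (singular_locus f)"

definition proper_frontal ::
  "real^'n::finite \<Rightarrow> real^'m::finite \<Rightarrow> (real^'n \<Rightarrow> real^'m) \<Rightarrow> bool" where
  "proper_frontal a b f \<longleftrightarrow> frontal a b f \<and> proper_germ a f"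

subsection \<open>Local coordinates\<close>

text \<open>Not necessarily centered at \<open>b\<close>; \<open>y\<close> is the inverse of the coordinate map \<open>x\<close>.\<close>

definition local_coordinates :: "real^'m::finite \<Rightarrow> (real^'m \<Rightarrow> real^'m) \<Rightarrow> bool" where
  "local_coordinates b x \<longleftrightarrow>
     (\<exists>U y. open U \<and> b \<in> U \<and> open (x ` U) \<and> smooth_on U x \<and> smooth_on (x ` U) y \<and>
            (\<forall>p\<in>U. y (x p) = p))"

definition centered_coordinates :: "real^'m::finite \<Rightarrow> (real^'m \<Rightarrow> real^'m) \<Rightarrow> bool" where
  "centered_coordinates b x \<longleftrightarrow> local_coordinates b x \<and> x b = 0"

text \<open>\<open>(\<partial>/\<partial>x\<^sub>j)\<^sub>b\<close> is the image of the \<open>j\<close>-th standard basis vector under the inverse of the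
  differential of \<open>x\<close> at \<open>b\<close>.\<close>

definition coordinate_vector ::
  "(real^'m::finite \<Rightarrow> real^'m) \<Rightarrow> real^'m \<Rightarrow> 'm \<Rightarrow> real^'m" where
  "coordinate_vector x b j = inv (frechet_derivative x (at b)) (axis j 1)"

definition adapted ::
  "('n::finite \<Rightarrow> 'm::finite) \<Rightarrow> real^'n \<Rightarrow> real^'m \<Rightarrow>
     (real^'n \<Rightarrow> (real^'m) \<times> (real^'m) set) \<Rightarrow> (real^'m \<Rightarrow> real^'m) \<Rightarrow> bool" where
  "adapted \<iota> a b F x \<longleftrightarrow> F a = (b, span (range (\<lambda>i. coordinate_vector x b (\<iota> i))))"

subsection \<open>Openings\<close>

text \<open>A germ of a 1-form is a function sending a point to a linear functional.\<close>

definition differential :: "('a::euclidean_space \<Rightarrow> real) \<Rightarrow> 'a \<Rightarrow> 'a \<Rightarrow> real" where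
  "differential h t = frechet_derivative h (at t)"

definition jacobi_module ::
  "real^'n::finite \<Rightarrow> (real^'n \<Rightarrow> real^'n) \<Rightarrow> (real^'n \<Rightarrow> real^'n \<Rightarrow> real) set" where
  "jacobi_module a g =
     {\<omega>. \<exists>h. (\<forall>j. smooth_germ a (h j)) \<and>
          (\<forall>\<^sub>F t in nhds a. \<omega> t = (\<lambda>v. \<Sum>j\<in>UNIV. h j t * differential (\<lambda>s. g s $ j) t v))}"

definition opening_via ::
  "('n::finite \<Rightarrow> 'm::finite) \<Rightarrow> real^'n \<Rightarrow> real^'m \<Rightarrow> (real^'m \<Rightarrow> real^'m) \<Rightarrow>
     (real^'n \<Rightarrow> real^'m) \<Rightarrow> (real^'n \<Rightarrow> real^'n) \<Rightarrow> bool" where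
  "opening_via \<iota> a b x f g \<longleftrightarrow>
     map_germ a b f \<and> smooth_germ a g \<and> local_coordinates b x \<and>
     (\<forall>\<^sub>F t in nhds a. \<forall>i. x (f t) $ \<iota> i = g t $ i) \<and>
     (\<forall>j. j \<notin> range \<iota> \<longrightarrow> differential (\<lambda>t. x (f t) $ j) \<in> jacobi_module a g)"

definition is_opening ::
  "('n::finite \<Rightarrow> 'm::finite) \<Rightarrow> real^'n \<Rightarrow> real^'m \<Rightarrow>
     (real^'n \<Rightarrow> real^'m) \<Rightarrow> (real^'n \<Rightarrow> real^'n) \<Rightarrow> bool" where
  "is_opening \<iota> a b f g \<longleftrightarrow> (\<exists>x. opening_via \<iota> a b x f g)"

end

theory Submission
  imports Defs
begin

text \<open>
  Everything rests on one description of the Jacobian matrix \<open>Jf\<close>: a smooth germ \<open>f\<close> is a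
  frontal precisely when \<open>Jf = M ** B\<close> near \<open>a\<close>, where \<open>M\<close> is a smooth family of injective
  matrices of the shape \<open>m\<close> by \<open>n\<close>, and \<open>B\<close> is any family of square matrices. The
  columns of \<open>M t\<close> span the plane of a Legendre lift. That this plane depends smoothly on \<open>t\<close> is seen in a chart of the
  Grassmannian: an injective \<open>M a\<close> has \<open>n\<close> independent rows, the square submatrix \<open>K\<close> of
  these rows stays invertible near \<open>a\<close>, and \<open>M ** matrix_inv K\<close> is the normalised chart matrix;
  it is smooth by Cramer's rule. This is \<open>frontal_if_jacobian_factors\<close>.

  An opening of \<open>g\<close> has such a factorization with \<open>B = Jg\<close>. In the given coordinates
  \<open>x\<close>, the rows of \<open>J(x \<circ> f)\<close> are either rows of \<open>Jg\<close> or smooth combinations of them, so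
  \<open>J(x \<circ> f) = H ** Jg\<close> with identity rows in \<open>H\<close>; applying the invertible Jacobian of the
  inverse coordinate map gives \<open>M\<close>. This is \<open>opening_jacobian_factorization\<close>. Hence openings are
  frontals, and since \<open>M\<close> is injective, \<open>f\<close> and \<open>g\<close> have the same singular points near \<open>a\<close>,
  which settles properness (\<open>proper_germ_iff_if_jacobian_factors\<close>).

  Conversely, let \<open>Jf = A ** B\<close> come from a chart matrix \<open>A\<close> of a Legendre lift and put
  \<open>D = Jx ** A\<close>, so that \<open>J(x \<circ> f) = D ** B\<close>. That the coordinates are adapted means that at \<open>a\<close>
  all rows of \<open>D\<close> vanish except those at the positions \<open>\<iota> i\<close>. The latter form a square matrix
  \<open>P\<close>, which is therefore invertible at \<open>a\<close>, hence near \<open>a\<close>; as \<open>Jg = P ** B\<close>, the unknown and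
  possibly singular \<open>B\<close> can be eliminated: \<open>J(x \<circ> f) = (D ** matrix_inv P) ** Jg\<close>. The entries of \<open>D ** matrix_inv P\<close> are
  the smooth coefficients required by the Jacobi module. This is \<open>adapted_frontal_opening_via\<close>.
\<close>

section \<open>Calculus of \<open>C\<^sup>k\<close> maps\<close>

lemma has_derivative_cong_eventually:
  assumes "\<forall>\<^sub>F y in nhds x. f y = g y"
  shows "(f has_derivative D) (at x) \<longleftrightarrow> (g has_derivative D) (at x)"
proof -
  have "(q has_derivative D) (at x)"
    if "\<forall>\<^sub>F y in nhds x. p y = q y" "(p has_derivative D) (at x)" for p q
    using that eventually_nhds_x_imp_x[OF that(1)]
    by (intro has_derivative_transform_eventually[OF that(2)])
       (simp_all add: eventually_at_filter eventually_mono)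
  moreover have "\<forall>\<^sub>F y in nhds x. g y = f y"
    using assms by (simp add: eq_commute)
  ultimately show ?thesis using assms by blast
qed

lemma frechet_derivative_cong_eventually:
  assumes "\<forall>\<^sub>F y in nhds x. f y = g y"
  shows "frechet_derivative f (at x) = frechet_derivative g (at x)"
proof -
  have "(f has_derivative D) (at x) \<longleftrightarrow> (g has_derivative D) (at x)" for D
    by (rule has_derivative_cong_eventually[OF assms])
  then show ?thesis by (simp add: frechet_derivative_def)
qed

lemma differentiable_cong_eventually:
  assumes "\<forall>\<^sub>F y in nhds x. f y = g y"
  shows "f differentiable (at x) \<longleftrightarrow> g differentiable (at x)"
proof -
  have "(f has_derivative D) (at x) \<longleftrightarrow> (g has_derivative D) (at x)" for D
    by (rule has_derivative_cong_eventually[OF assms])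
  then show ?thesis by (simp add: differentiable_def)
qed

lemma Ck_on_cong:
  assumes "open U" "\<And>x. x \<in> U \<Longrightarrow> f x = g x" "Ck_on k U f"
  shows "Ck_on k U g"
  using assms(2,3)
proof (induction k arbitrary: f g)
  case 0
  then show ?case using continuous_on_cong[of U U f g] by simp
next
  case (Suc k)
  have ev: "\<forall>\<^sub>F y in nhds x. f y = g y" if "x \<in> U" for x
    using eventually_nhds_in_open[OF assms(1) that] by eventually_elim (rule Suc.prems(1))
  have "Ck_on k U (\<lambda>x. frechet_derivative g (at x) v)" for v
  proof (rule Suc.IH)
    show "Ck_on k U (\<lambda>x. frechet_derivative f (at x) v)" using Suc.prems(2) by simp
  qed (simp add: frechet_derivative_cong_eventually[OF ev])
  moreover have "g differentiable (at x)" if "x \<in> U" for x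
    using Suc.prems(2) that differentiable_cong_eventually[OF ev[OF that]] by simp
  ultimately show ?case by simp
qed

lemma Ck_on_subset: "Ck_on k U f \<Longrightarrow> V \<subseteq> U \<Longrightarrow> Ck_on k V f"
  by (induction k arbitrary: f) (auto intro: continuous_on_subset)

lemma Ck_on_SucD: "Ck_on (Suc k) U f \<Longrightarrow> Ck_on k U f"
proof (induction k arbitrary: f)
  case 0
  then show ?case
    by (auto intro!: continuous_at_imp_continuous_on differentiable_imp_continuous_within)
next
  case (Suc k)
  have "Ck_on k U (\<lambda>x. frechet_derivative f (at x) v)" for v
    using Suc.prems by (intro Suc.IH) (simp only: Ck_on.simps(2)[of "Suc k"])
  then show ?case
    using Suc.prems by (simp only: Ck_on.simps(2)) blast
qed

text \<open>The derivative is only prescribed on \<open>U\<close>. This lets each closure property below be proved from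
  the corresponding differentiation rule by induction on the order.\<close>

lemma Ck_on_SucI:
  assumes "open U" "\<And>x. x \<in> U \<Longrightarrow> (f has_derivative f' x) (at x)"
    "\<And>v. Ck_on k U (\<lambda>x. f' x v)"
  shows "Ck_on (Suc k) U f"
proof -
  have "Ck_on k U (\<lambda>x. frechet_derivative f (at x) v)" for v
    by (rule Ck_on_cong[OF assms(1) _ assms(3)[of v]]) (simp add: frechet_derivative_at[OF assms(2), symmetric])
  then show ?thesis using assms(2) by (auto simp: differentiable_def)
qed

lemma Ck_on_Suc_has_derivative:
  assumes "Ck_on (Suc k) U f" "x \<in> U"
  shows "(f has_derivative frechet_derivative f (at x)) (at x)"
  using assms frechet_derivative_works by auto

lemma Ck_on_const: "open U \<Longrightarrow> Ck_on k U (\<lambda>x. c)"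
proof (induction k arbitrary: c)
  case (Suc k)
  then show ?case by (rule_tac Ck_on_SucI[where f'="\<lambda>_ _. 0"]) auto
qed simp

lemma Ck_on_bounded_linear:
  assumes "open U" "bounded_linear L" "Ck_on k U f"
  shows "Ck_on k U (\<lambda>x. L (f x))"
  using assms(3)
proof (induction k arbitrary: f)
  case 0
  then show ?case by (simp add: bounded_linear.continuous_on[OF assms(2)])
next
  case (Suc k)
  let ?D = "\<lambda>x v. L (frechet_derivative f (at x) v)"
  show ?case
  proof (rule Ck_on_SucI[where f'="?D"])
    fix x assume "x \<in> U"
    then show "((\<lambda>x. L (f x)) has_derivative ?D x) (at x)"
      by (intro bounded_linear.has_derivative[OF assms(2)] Ck_on_Suc_has_derivative[OF Suc.prems])
  next
    fix v
    show "Ck_on k U (\<lambda>x. ?D x v)" using Suc.prems by (intro Suc.IH) simp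
  qed (rule assms(1))
qed

lemma Ck_on_add:
  assumes "open U" "Ck_on k U f" "Ck_on k U g"
  shows "Ck_on k U (\<lambda>x. f x + g x)"
  using assms(2,3)
proof (induction k arbitrary: f g)
  case 0
  then show ?case by (simp add: continuous_on_add)
next
  case (Suc k)
  let ?D = "\<lambda>x v. frechet_derivative f (at x) v + frechet_derivative g (at x) v"
  show ?case
  proof (rule Ck_on_SucI[where f'="?D"])
    fix x assume "x \<in> U"
    then show "((\<lambda>x. f x + g x) has_derivative ?D x) (at x)"
      by (intro has_derivative_add Ck_on_Suc_has_derivative[OF Suc.prems(1)]
            Ck_on_Suc_has_derivative[OF Suc.prems(2)])
  next
    fix v
    show "Ck_on k U (\<lambda>x. ?D x v)" using Suc.prems by (intro Suc.IH) simp_all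
  qed (rule assms(1))
qed

lemma Ck_on_sum:
  assumes "open U" "\<And>i. i \<in> I \<Longrightarrow> Ck_on k U (f i)"
  shows "Ck_on k U (\<lambda>x. \<Sum>i\<in>I. f i x)"
  using assms(2)
  by (induction I rule: infinite_finite_induct) (simp_all add: Ck_on_const Ck_on_add assms(1))

lemma Ck_on_scaleR:
  assumes "open U" "Ck_on k U f" "Ck_on k U g"
  shows "Ck_on k U (\<lambda>x. f x *\<^sub>R g x)"
  using assms(2,3)
proof (induction k arbitrary: f g)
  case 0
  then show ?case by (simp add: continuous_on_scaleR)
next
  case (Suc k)
  show ?case
  proof (rule Ck_on_SucI[where f'="\<lambda>x v. f x *\<^sub>R frechet_derivative g (at x) v
                                           + frechet_derivative f (at x) v *\<^sub>R g x"])
    fix x assume "x \<in> U"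
    then show "((\<lambda>x. f x *\<^sub>R g x) has_derivative (\<lambda>v. f x *\<^sub>R frechet_derivative g (at x) v
                  + frechet_derivative f (at x) v *\<^sub>R g x)) (at x)"
      by (intro has_derivative_scaleR Ck_on_Suc_has_derivative[OF Suc.prems(1)]
            Ck_on_Suc_has_derivative[OF Suc.prems(2)])
  next
    fix v
    show "Ck_on k U (\<lambda>x. f x *\<^sub>R frechet_derivative g (at x) v
                         + frechet_derivative f (at x) v *\<^sub>R g x)"
      using Suc.prems Suc.prems[THEN Ck_on_SucD] by (intro Ck_on_add Suc.IH assms(1)) simp_all
  qed (rule assms(1))
qed

text \<open>In a basis, the chain rule turns the derivative of \<open>g \<circ> f\<close> in direction \<open>v\<close> into a finite sum
  of products of a component of the derivative of \<open>f\<close> with a composite of \<open>f\<close> and a directional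
  derivative of \<open>g\<close> in a fixed direction. The latter has one order of differentiability less, so
  the induction on \<open>k\<close> must leave \<open>g\<close> arbitrary.\<close>

lemma Ck_on_compose:
  fixes f :: "'a::euclidean_space \<Rightarrow> 'b::euclidean_space" and g :: "'b \<Rightarrow> 'c::real_normed_vector"
  assumes "open U" "f ` U \<subseteq> V" "Ck_on k U f" "Ck_on k V g"
  shows "Ck_on k U (\<lambda>x. g (f x))"
  using assms(3,4)
proof (induction k arbitrary: g)
  case 0
  then show ?case using assms(2) continuous_on_compose2[of V g U f] by simp
next
  case (Suc k)
  let ?D = "\<lambda>x v. frechet_derivative g (at (f x)) (frechet_derivative f (at x) v)"
  show ?case
  proof (rule Ck_on_SucI[where f'="?D"])
    fix x assume "x \<in> U"
    then show "((\<lambda>x. g (f x)) has_derivative ?D x) (at x)"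
      using assms(2) has_derivative_compose[OF Ck_on_Suc_has_derivative[OF Suc.prems(1)]
            Ck_on_Suc_has_derivative[OF Suc.prems(2)]] by auto
  next
    fix v
    have "Ck_on k U (\<lambda>x. \<Sum>e\<in>Basis. (frechet_derivative f (at x) v \<bullet> e) *\<^sub>R
                              frechet_derivative g (at (f x)) e)"
      using Suc.prems Suc.prems(1)[THEN Ck_on_SucD]
      by (intro Ck_on_sum Ck_on_scaleR assms(1) Suc.IH
            Ck_on_bounded_linear[OF assms(1) bounded_linear_inner_left]) simp_all
    moreover have "(\<Sum>e\<in>Basis. (frechet_derivative f (at x) v \<bullet> e) *\<^sub>R
                              frechet_derivative g (at (f x)) e) = ?D x v" if "x \<in> U" for x
    proof -
      have "linear (frechet_derivative g (at (f x)))"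
        using that assms(2) Suc.prems(2) by (auto intro!: linear_frechet_derivative)
      then have "?D x v = (\<Sum>e\<in>Basis. frechet_derivative g (at (f x))
                    ((frechet_derivative f (at x) v \<bullet> e) *\<^sub>R e))"
        by (metis (no_types) euclidean_representation linear_sum)
      then show ?thesis
        by (simp add: linear_cmul[OF \<open>linear _\<close>])
    qed
    ultimately show "Ck_on k U (\<lambda>x. ?D x v)"
      by (rule Ck_on_cong[OF assms(1), rotated])
  qed (rule assms(1))
qed

lemma Ck_on_inverse:
  fixes f :: "'a::euclidean_space \<Rightarrow> real"
  assumes "open U" "\<And>x. x \<in> U \<Longrightarrow> f x \<noteq> 0" "Ck_on k U f"
  shows "Ck_on k U (\<lambda>x. inverse (f x))"
  using assms(3)
proof (induction k)
  case 0
  then show ?case using assms(2) by (auto intro!: continuous_on_inverse)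
next
  case (Suc k)
  let ?D = "\<lambda>x v. (- 1) *\<^sub>R (inverse (f x) *\<^sub>R frechet_derivative f (at x) v *\<^sub>R inverse (f x))"
  show ?case
  proof (rule Ck_on_SucI[where f'="?D"])
    fix x assume "x \<in> U"
    then show "((\<lambda>x. inverse (f x)) has_derivative ?D x) (at x)"
      using Deriv.has_derivative_inverse[OF assms(2) Ck_on_Suc_has_derivative[OF Suc.prems]] by (simp add: mult.assoc)
  next
    fix v
    show "Ck_on k U (\<lambda>x. ?D x v)"
      using Suc.prems Suc.IH[OF Suc.prems[THEN Ck_on_SucD]]
      by (intro Ck_on_scaleR Ck_on_const assms(1)) simp_all
  qed (rule assms(1))
qed

section \<open>Smooth germs\<close>

lemma smooth_germE:
  assumes "smooth_germ a f"
  obtains U where "open U" "a \<in> U" "\<And>k. Ck_on k U f"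
  using assms unfolding smooth_germ_def smooth_on_def by blast

lemma smooth_germI: "open U \<Longrightarrow> a \<in> U \<Longrightarrow> (\<And>k. Ck_on k U f) \<Longrightarrow> smooth_germ a f"
  unfolding smooth_germ_def smooth_on_def by blast

lemma smooth_germ_cong:
  assumes "smooth_germ a f" "\<forall>\<^sub>F t in nhds a. f t = g t"
  shows "smooth_germ a g"
proof -
  obtain U where U: "open U" "a \<in> U" "\<And>k. Ck_on k U f"
    using smooth_germE[OF assms(1)] by blast
  obtain V where V: "open V" "a \<in> V" "\<And>t. t \<in> V \<Longrightarrow> f t = g t"
    using assms(2) unfolding eventually_nhds by blast
  have "Ck_on k (U \<inter> V) g" for k
    by (rule Ck_on_cong[OF open_Int[OF U(1) V(1)] _ Ck_on_subset[OF U(3)]]) (simp_all add: V(3))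
  then show ?thesis
    using U(1,2) V(1,2) by (intro smooth_germI[of "U \<inter> V"]) auto
qed

lemma smooth_germ_eventually:
  assumes "smooth_germ a f"
  shows "\<forall>\<^sub>F t in nhds a. smooth_germ t f"
  using assms unfolding smooth_germ_def eventually_nhds by blast

lemma smooth_germ_differentiable: "smooth_germ a f \<Longrightarrow> f differentiable (at a)"
  by (erule smooth_germE) (use Ck_on.simps(2)[of 0] in blast)

lemma smooth_germ_tendsto: "smooth_germ a f \<Longrightarrow> (f \<longlongrightarrow> f a) (nhds a)"
  using differentiable_imp_continuous_within[OF smooth_germ_differentiable[of a f]]
  by (simp add: continuous_within tendsto_at_iff_tendsto_nhds)

lemma smooth_germ_const: "smooth_germ a (\<lambda>t. c)"
  by (rule smooth_germI[of UNIV]) (simp_all add: Ck_on_const)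

lemma smooth_germ_bounded_linear:
  "bounded_linear L \<Longrightarrow> smooth_germ a f \<Longrightarrow> smooth_germ a (\<lambda>t. L (f t))"
  by (erule smooth_germE) (rule smooth_germI, assumption+, rule Ck_on_bounded_linear)

lemma smooth_germ_common_neighbourhood:
  assumes "smooth_germ a f" "smooth_germ a g"
  obtains U where "open U" "a \<in> U" "\<And>k. Ck_on k U f" "\<And>k. Ck_on k U g"
proof -
  obtain U where U: "open U" "a \<in> U" "\<And>k. Ck_on k U f"
    using smooth_germE[OF assms(1)] by blast
  obtain V where V: "open V" "a \<in> V" "\<And>k. Ck_on k V g"
    using smooth_germE[OF assms(2)] by blast
  show ?thesis
    by (rule that[of "U \<inter> V"])
      (use U(1,2) V(1,2) in \<open>simp_all add: open_Int Ck_on_subset[OF U(3)] Ck_on_subset[OF V(3)]\<close>)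
qed

lemma smooth_germ_add:
  assumes "smooth_germ a f" "smooth_germ a g"
  shows "smooth_germ a (\<lambda>t. f t + g t)"
  using assms
  by (rule smooth_germ_common_neighbourhood) (rule smooth_germI, assumption+, rule Ck_on_add)

lemma smooth_germ_scaleR:
  assumes "smooth_germ a f" "smooth_germ a g"
  shows "smooth_germ a (\<lambda>t. f t *\<^sub>R g t)"
  using assms
  by (rule smooth_germ_common_neighbourhood) (rule smooth_germI, assumption+, rule Ck_on_scaleR)

lemma smooth_germ_mult:
  fixes f g :: "'a::euclidean_space \<Rightarrow> real"
  shows "smooth_germ a f \<Longrightarrow> smooth_germ a g \<Longrightarrow> smooth_germ a (\<lambda>t. f t * g t)"
  using smooth_germ_scaleR[of a f g] by simp

lemma smooth_germ_sum:
  "(\<And>i. i \<in> I \<Longrightarrow> smooth_germ a (f i)) \<Longrightarrow> smooth_germ a (\<lambda>t. \<Sum>i\<in>I. f i t)"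
  by (induction I rule: infinite_finite_induct) (simp_all add: smooth_germ_const smooth_germ_add)

lemma smooth_germ_prod:
  fixes f :: "'i \<Rightarrow> 'a::euclidean_space \<Rightarrow> real"
  shows "(\<And>i. i \<in> I \<Longrightarrow> smooth_germ a (f i)) \<Longrightarrow> smooth_germ a (\<lambda>t. \<Prod>i\<in>I. f i t)"
  by (induction I rule: infinite_finite_induct) (simp_all add: smooth_germ_const smooth_germ_mult)

lemma smooth_germ_inverse:
  fixes f :: "'a::euclidean_space \<Rightarrow> real"
  assumes "smooth_germ a f" "f a \<noteq> 0"
  shows "smooth_germ a (\<lambda>t. inverse (f t))"
proof -
  obtain U where U: "open U" "a \<in> U" "\<And>k. Ck_on k U f"
    using smooth_germE[OF assms(1)] by blast
  have "\<forall>\<^sub>F t in nhds a. f t \<noteq> 0"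
    using smooth_germ_tendsto[OF assms(1)] assms(2) by (rule tendsto_imp_eventually_ne)
  then obtain V where V: "open V" "a \<in> V" "\<And>t. t \<in> V \<Longrightarrow> f t \<noteq> 0"
    unfolding eventually_nhds by blast
  have "Ck_on k (U \<inter> V) (\<lambda>t. inverse (f t))" for k
    by (rule Ck_on_inverse[OF open_Int[OF U(1) V(1)] _ Ck_on_subset[OF U(3)]]) (simp_all add: V(3))
  then show ?thesis
    using U(1,2) V(1,2) by (intro smooth_germI[of "U \<inter> V"]) auto
qed

lemma smooth_germ_compose:
  fixes f :: "'a::euclidean_space \<Rightarrow> 'b::euclidean_space" and g :: "'b \<Rightarrow> 'c::real_normed_vector"
  assumes "smooth_germ a f" "smooth_germ (f a) g"
  shows "smooth_germ a (\<lambda>t. g (f t))"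
proof -
  obtain U where U: "open U" "a \<in> U" "\<And>k. Ck_on k U f"
    using smooth_germE[OF assms(1)] by blast
  obtain V where V: "open V" "f a \<in> V" "\<And>k. Ck_on k V g"
    using smooth_germE[OF assms(2)] by blast
  have "open (U \<inter> f -` V)"
    using U(3)[of 0] continuous_open_preimage[OF _ U(1) V(1)] by simp
  moreover from this have "Ck_on k (U \<inter> f -` V) (\<lambda>t. g (f t))" for k
    by (rule Ck_on_compose[OF _ _ Ck_on_subset[OF U(3)] V(3)]) auto
  ultimately show ?thesis
    using U(2) V(2) by (intro smooth_germI[of "U \<inter> f -` V"]) auto
qed

lemma smooth_germ_frechet_derivative:
  "smooth_germ a f \<Longrightarrow> smooth_germ a (\<lambda>t. frechet_derivative f (at t) v)"
  by (erule smooth_germE, rule smooth_germI, assumption+) (use Ck_on.simps(2) in blast)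

text \<open>A vector is the sum of its components placed on the axes, which reduces smoothness to bounded
  linear maps and sums.\<close>

lemma smooth_germ_vec_iff:
  fixes f :: "'a::euclidean_space \<Rightarrow> 'b::euclidean_space^'i::finite"
  shows "smooth_germ a f \<longleftrightarrow> (\<forall>i. smooth_germ a (\<lambda>t. f t $ i))"
proof
  assume "smooth_germ a f"
  then show "\<forall>i. smooth_germ a (\<lambda>t. f t $ i)"
    by (intro allI smooth_germ_bounded_linear[OF bounded_linear_vec_nth])
next
  assume comp: "\<forall>i. smooth_germ a (\<lambda>t. f t $ i)"
  have "linear (axis i :: 'b \<Rightarrow> 'b^'i)" for i
    by (rule linearI) (simp_all add: vec_eq_iff axis_def)
  then have "bounded_linear (axis i :: 'b \<Rightarrow> 'b^'i)" for i
    by (simp add: linear_conv_bounded_linear)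
  with comp have "smooth_germ a (\<lambda>t. \<Sum>i\<in>UNIV. axis i (f t $ i))"
    by (intro smooth_germ_sum smooth_germ_bounded_linear[of "axis _"]) simp_all
  moreover have "(\<Sum>i\<in>UNIV. axis i (x $ i)) = x" for x :: "'b^'i"
    by (simp add: vec_eq_iff axis_def)
  ultimately show "smooth_germ a f" by simp
qed

section \<open>Smooth families of matrices\<close>

lemma smooth_germ_matrix_iff:
  fixes A :: "'a::euclidean_space \<Rightarrow> real^'n::finite^'m::finite"
  shows "smooth_germ a A \<longleftrightarrow> (\<forall>i j. smooth_germ a (\<lambda>t. A t $ i $ j))"
  by (simp add: smooth_germ_vec_iff)

lemma smooth_germ_matrix_mult:
  fixes A :: "'a::euclidean_space \<Rightarrow> real^'n::finite^'m::finite" and B :: "'a \<Rightarrow> real^'k::finite^'n"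
  assumes "smooth_germ a A" "smooth_germ a B"
  shows "smooth_germ a (\<lambda>t. A t ** B t)"
  using assms
  by (simp add: smooth_germ_matrix_iff matrix_matrix_mult_def smooth_germ_sum smooth_germ_mult)

lemma smooth_germ_det:
  fixes A :: "'a::euclidean_space \<Rightarrow> real^'n::finite^'n"
  assumes "smooth_germ a A"
  shows "smooth_germ a (\<lambda>t. det (A t))"
  unfolding det_def using assms
  by (intro smooth_germ_sum smooth_germ_mult smooth_germ_const smooth_germ_prod)
     (simp add: smooth_germ_matrix_iff)

lemma invertible_matrix_inv:
  fixes A :: "real^'n::finite^'n"
  assumes "invertible A"
  shows "A ** matrix_inv A = mat 1" "matrix_inv A ** A = mat 1"
  using someI_ex[OF assms[unfolded invertible_def]] unfolding matrix_inv_def by auto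

lemma invertible_eventually:
  fixes A :: "'a::euclidean_space \<Rightarrow> real^'n::finite^'n"
  assumes "smooth_germ a A" "invertible (A a)"
  shows "\<forall>\<^sub>F t in nhds a. invertible (A t)"
  using tendsto_imp_eventually_ne[OF smooth_germ_tendsto[OF smooth_germ_det[OF assms(1)]]] assms(2)
  by (simp add: invertible_det_nz)

text \<open>By Cramer's rule every entry of the inverse is a quotient of determinants.\<close>

lemma smooth_germ_matrix_inv:
  fixes A :: "'a::euclidean_space \<Rightarrow> real^'n::finite^'n"
  assumes "smooth_germ a A" "invertible (A a)"
  shows "smooth_germ a (\<lambda>t. matrix_inv (A t))"
  unfolding smooth_germ_matrix_iff
proof (intro allI)
  fix k j
  let ?R = "\<lambda>t. \<chi> i l. if l = k then axis j 1 $ i else A t $ i $ l"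
  have "smooth_germ a (\<lambda>t. ?R t $ i $ l)" for i l
    using assms(1) by (cases "l = k") (simp_all add: smooth_germ_matrix_iff smooth_germ_const)
  then have "smooth_germ a ?R"
    unfolding smooth_germ_matrix_iff by blast
  then have "smooth_germ a (\<lambda>t. det (?R t) * inverse (det (A t)))"
    using assms by (intro smooth_germ_mult smooth_germ_inverse smooth_germ_det)
                   (simp_all add: invertible_det_nz)
  moreover have "\<forall>\<^sub>F t in nhds a. det (?R t) * inverse (det (A t)) = matrix_inv (A t) $ k $ j"
    using invertible_eventually[OF assms]
  proof eventually_elim
    case (elim t)
    have "A t *v (matrix_inv (A t) *v axis j 1) = axis j 1"
      by (simp add: matrix_vector_mul_assoc invertible_matrix_inv(1)[OF elim])
    then have "matrix_inv (A t) *v axis j 1 =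
        (\<chi> k. det (\<chi> i l. if l = k then axis j 1 $ i else A t $ i $ l) / det (A t))"
      by (rule cramer[THEN iffD1, rotated]) (use elim in \<open>simp add: invertible_det_nz\<close>)
    then have "(matrix_inv (A t) *v axis j 1) $ k = det (?R t) / det (A t)" by simp
    then show ?case
      by (simp add: matrix_vector_mult_basis column_def divide_inverse)
  qed
  ultimately show "smooth_germ a (\<lambda>t. matrix_inv (A t) $ k $ j)"
    by (rule smooth_germ_cong)
qed

section \<open>Jacobian matrices\<close>

lemma smooth_germ_jacobian:
  fixes f :: "real^'n::finite \<Rightarrow> real^'m::finite"
  assumes "smooth_germ a f"
  shows "smooth_germ a (\<lambda>t. jacobian f (at t))"
  using smooth_germ_frechet_derivative[OF assms]
  by (simp add: smooth_germ_matrix_iff jacobian_def matrix_def smooth_germ_vec_iff)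

lemma frechet_derivative_jacobian:
  fixes f :: "real^'n::finite \<Rightarrow> real^'m::finite"
  assumes "f differentiable (at t)"
  shows "frechet_derivative f (at t) = (\<lambda>v. jacobian f (at t) *v v)"
  using frechet_derivative_at[OF jacobian_works[THEN iffD1, OF assms]] by (rule sym)

lemma jacobian_compose:
  fixes f :: "real^'n::finite \<Rightarrow> real^'m::finite" and g :: "real^'m \<Rightarrow> real^'k::finite"
  assumes "f differentiable (at t)" "g differentiable (at (f t))"
  shows "jacobian (\<lambda>s. g (f s)) (at t) = jacobian g (at (f t)) ** jacobian f (at t)"
proof -
  have "((\<lambda>s. g (f s)) has_derivative (\<lambda>v. jacobian g (at (f t)) *v (jacobian f (at t) *v v))) (at t)"
    by (rule has_derivative_compose[OF assms[THEN jacobian_works[THEN iffD1]]])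
  from frechet_derivative_at[OF this]
  have "frechet_derivative (\<lambda>s. g (f s)) (at t) = (*v) (jacobian g (at (f t)) ** jacobian f (at t))"
    by (simp add: fun_eq_iff matrix_vector_mul_assoc)
  then show ?thesis
    by (simp only: jacobian_def[of "\<lambda>s. g (f s)"] matrix_of_matrix_vector_mul)
qed

lemma differential_component:
  fixes u :: "real^'n::finite \<Rightarrow> real^'m::finite"
  assumes "u differentiable (at t)"
  shows "differential (\<lambda>s. u s $ j) t = (\<lambda>v. (jacobian u (at t) *v v) $ j)"
  unfolding differential_def
  by (intro frechet_derivative_at[symmetric] bounded_linear.has_derivative[OF bounded_linear_vec_nth]
        jacobian_works[THEN iffD1] assms)

section \<open>Selecting rows of a matrix\<close>

definition select_rows :: "('n \<Rightarrow> 'm) \<Rightarrow> real^'k^'m::finite \<Rightarrow> real^'k^'n::finite" where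
  "select_rows \<kappa> M = (\<chi> i. M $ \<kappa> i)"

lemma select_rows_mult:
  "select_rows \<kappa> (M ** N) = select_rows \<kappa> M ** (N :: real^'k::finite^'n::finite)"
  by (simp add: select_rows_def matrix_matrix_mult_def vec_eq_iff)

lemma select_rows_mult_vec: "(select_rows \<kappa> M *v v) $ i = (M *v v) $ \<kappa> i"
  by (simp add: select_rows_def matrix_vector_mult_def)

lemma smooth_germ_select_rows:
  "smooth_germ a M \<Longrightarrow> smooth_germ a (\<lambda>t. select_rows \<kappa> (M t))"
  by (simp add: smooth_germ_matrix_iff select_rows_def)

lemma inj_matrix_iff: "inj ((*v) A) \<longleftrightarrow> (\<forall>v. A *v v = 0 \<longrightarrow> v = 0)"
  for A :: "real^'n::finite^'m::finite"
  by (rule linear_injective_0) simp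

lemma identity_rows_mult_vec:
  fixes A :: "real^'n::finite^'m::finite"
  assumes "\<forall>i. A $ \<kappa> i = axis i 1"
  shows "(A *v v) $ \<kappa> i = v $ i"
  using assms by (simp add: matrix_vector_mul_component inner_axis')

text \<open>This is why the matrix of a plane in a chart of the Grassmannian has full rank.\<close>

lemma inj_matrix_if_identity_rows:
  fixes A :: "real^'n::finite^'m::finite"
  assumes "\<forall>i. A $ \<kappa> i = axis i 1"
  shows "inj ((*v) A)"
  unfolding inj_matrix_iff vec_eq_iff by (metis identity_rows_mult_vec[OF assms] zero_index)

text \<open>Injectivity means that the rows span the whole space, so a basis can be chosen among them. This
  finds a chart of the Grassmannian around a plane given by any spanning matrix.\<close>

lemma exists_invertible_row_selection:
  fixes M :: "real^'n::finite^'m::finite"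
  assumes "inj ((*v) M)"
  obtains \<kappa> :: "'n \<Rightarrow> 'm" where "inj \<kappa>" "invertible (select_rows \<kappa> M)"
proof -
  have "span (rows M) = UNIV"
    using assms matrix_left_invertible_injective matrix_left_invertible_span_rows by blast
  then obtain B where B: "B \<subseteq> rows M" "independent B" "span B = UNIV"
    using maximal_independent_subset[of "rows M"] span_mono[of "rows M"] span_span by (metis UNIV_eq_I UNIV_I subsetD)
  have "card B = CARD('n)"
    using basis_card_eq_dim[of B UNIV] B by simp
  moreover have "finite B"
    using B(2) by (rule independent_imp_finite)
  ultimately obtain e where e: "bij_betw e (UNIV :: 'n set) B"
    using finite_same_card_bij[of "UNIV :: 'n set" B] by auto
  have "\<exists>j. e i = M $ j" for i
    using bij_betwE[OF e] B(1) by (auto simp: rows_def row_def vec_lambda_eta)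
  then obtain \<kappa> where \<kappa>: "\<And>i. e i = M $ \<kappa> i" by metis
  have "inj \<kappa>"
    using e unfolding bij_betw_def inj_on_def by (metis \<kappa>)
  moreover have "rows (select_rows \<kappa> M) = B"
    using e by (auto simp: rows_def row_def vec_lambda_eta select_rows_def bij_betw_def \<kappa>[symmetric])
  then have "invertible (select_rows \<kappa> M)"
    using B(3) by (simp add: invertible_left_inverse matrix_left_invertible_span_rows)
  ultimately show thesis by (rule that)
qed

text \<open>Turns the inclusion of the tangent image of a frontal in the plane of its Legendre lift into an
  equation between matrices, one point at a time.\<close>

lemma matrix_factor_if_range_subset:
  fixes J :: "real^'k::finite^'m::finite" and A :: "real^'n::finite^'m"
  assumes "range ((*v) J) \<subseteq> range ((*v) A)"
  obtains B where "J = A ** B"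
proof -
  have "\<exists>w. J *v axis j 1 = A *v w" for j
    using assms by blast
  then obtain w where w: "\<And>j. J *v axis j 1 = A *v w j" by metis
  have "J $ i $ j = (A *v w j) $ i" for i j
    by (simp add: column_def matrix_vector_mult_basis flip: w)
  then have "J = A ** (\<chi> i j. w j $ i)"
    by (simp add: vec_eq_iff matrix_matrix_mult_def matrix_vector_mult_def)
  then show thesis by (rule that)
qed

section \<open>Local coordinates\<close>

lemma jacobian_cong_eventually:
  "\<forall>\<^sub>F s in nhds t. f s = g s \<Longrightarrow> jacobian f (at t) = jacobian g (at t)"
  by (simp add: jacobian_def frechet_derivative_cong_eventually[of f g t])

lemma local_coordinates_inverse:
  fixes x :: "real^'m::finite \<Rightarrow> real^'m"
  assumes "local_coordinates b x"
  obtains y where "smooth_germ b x"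
    "\<forall>\<^sub>F p in nhds b. smooth_germ (x p) y \<and> y (x p) = p \<and>
       jacobian y (at (x p)) ** jacobian x (at p) = mat 1"
proof -
  obtain U y where U: "open U" "b \<in> U" "open (x ` U)" "smooth_on U x" "smooth_on (x ` U) y"
      "\<forall>p\<in>U. y (x p) = p"
    using assms unfolding local_coordinates_def by blast
  have x: "smooth_germ p x" and y: "smooth_germ (x p) y" if "p \<in> U" for p
    using U that unfolding smooth_germ_def by blast+
  have J: "jacobian y (at (x p)) ** jacobian x (at p) = mat 1" if "p \<in> U" for p
  proof -
    have "jacobian y (at (x p)) ** jacobian x (at p) = jacobian (\<lambda>q. y (x q)) (at p)"
      by (rule jacobian_compose[symmetric]) (use x y that in \<open>auto intro: smooth_germ_differentiable\<close>)
    also have "\<dots> = jacobian (\<lambda>q. q) (at p)"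
      using eventually_nhds_in_open[OF U(1) that] U(6)
      by (intro jacobian_cong_eventually) (auto elim: eventually_mono)
    also have "\<dots> = mat 1"
      by (simp add: jacobian_def frechet_derivative_ident matrix_id_mat_1 flip: id_def)
    finally show ?thesis .
  qed
  show thesis
  proof (rule that[OF x[OF U(2)]])
    show "\<forall>\<^sub>F p in nhds b. smooth_germ (x p) y \<and> y (x p) = p \<and>
       jacobian y (at (x p)) ** jacobian x (at p) = mat 1"
      using eventually_nhds_in_open[OF U(1,2)] by eventually_elim (use y J U(6) in blast)
  qed
qed

section \<open>Openings are frontals\<close>

text \<open>The columns of \<open>M t\<close> span the planes of the lift. Multiplying \<open>M\<close> by the inverse of an invertible
  selection of its rows changes neither these planes nor smoothness and yields the normalised matrix
  that a chart demands.\<close>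

lemma frontal_if_jacobian_factors:
  fixes f :: "real^'n::finite \<Rightarrow> real^'m::finite" and M :: "real^'n \<Rightarrow> real^'n^'m"
  assumes f: "map_germ a b f" and M: "smooth_germ a M" "inj ((*v) (M a))"
    and fac: "\<forall>\<^sub>F t in nhds a. \<exists>B. jacobian f (at t) = M t ** B"
  shows "frontal a b f"
proof -
  obtain \<kappa> :: "'n \<Rightarrow> 'm" where \<kappa>: "inj \<kappa>" "invertible (select_rows \<kappa> (M a))"
    using exists_invertible_row_selection[OF M(2)] .
  define K where "K = (\<lambda>t. select_rows \<kappa> (M t))"
  have K: "smooth_germ a K" "invertible (K a)"
    using smooth_germ_select_rows[OF M(1)] \<kappa>(2) by (simp_all add: K_def)
  define A where "A = (\<lambda>t. M t ** matrix_inv (K t))"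
  define F where "F t = (f t, range ((*v) (A t)))" for t
  have A: "smooth_germ a A"
    unfolding A_def by (intro smooth_germ_matrix_mult M(1) smooth_germ_matrix_inv K)
  have sf: "smooth_germ a f" using f by (simp add: map_germ_def)
  have rows: "\<forall>\<^sub>F t in nhds a. \<forall>i. A t $ \<kappa> i = axis i 1"
    using invertible_eventually[OF K]
  proof eventually_elim
    case (elim t)
    have "select_rows \<kappa> (A t) = mat 1"
      using invertible_matrix_inv(1)[OF elim] by (simp add: A_def select_rows_mult K_def)
    then show ?case by (simp add: select_rows_def vec_eq_iff mat_def axis_def eq_commute)
  qed
  have "\<forall>\<^sub>F t in nhds a. F t \<in> grassmann_bundle CARD('n)"
    using rows
  proof eventually_elim
    case (elim t)
    then have "dim (range ((*v) (A t))) = CARD('n)"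
      using inj_matrix_if_identity_rows full_rank_injective rank_dim_range by metis
    then show ?case
      by (simp add: F_def grassmann_bundle_def grassmannian_def linear_subspace_image)
  qed
  moreover have "\<forall>\<^sub>F t in nhds a. grassmann_chart \<kappa> (snd (F t)) (A t)"
    using rows by eventually_elim (simp add: grassmann_chart_def F_def)
  moreover have "\<forall>\<^sub>F t in nhds a. fst (F t) = f t \<and> range (frechet_derivative f (at t)) \<subseteq> snd (F t)"
    using fac smooth_germ_eventually[OF sf] invertible_eventually[OF K]
  proof eventually_elim
    case (elim t)
    then obtain B where B: "jacobian f (at t) = M t ** B" by blast
    have "M t = A t ** K t"
      using invertible_matrix_inv(2)[OF elim(3)] by (simp add: A_def flip: matrix_mul_assoc)
    then have "frechet_derivative f (at t) v = A t *v (K t *v (B *v v))" for v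
      using frechet_derivative_jacobian[OF smooth_germ_differentiable[OF elim(2)]] B
      by (simp add: matrix_vector_mul_assoc matrix_mul_assoc)
    then show ?case by (auto simp: F_def)
  qed
  moreover have "smooth_germ a (\<lambda>t. fst (F t))" using sf by (simp add: F_def)
  ultimately have "legendre_lift a f F"
    using A \<kappa>(1) unfolding legendre_lift_def smooth_germ_grassmann_bundle_def by blast
  then show ?thesis using f unfolding frontal_def by blast
qed

text \<open>With \<open>u = x \<circ> f\<close>, the opening condition says \<open>Ju = H ** Jg\<close>, where \<open>H\<close> consists of identity rows at
  the positions \<open>\<iota> i\<close> and of the smooth Jacobi module coefficients elsewhere. The identity rows make
  \<open>H\<close> injective, and passing back from \<open>u\<close> to \<open>f = y \<circ> u\<close> multiplies it by an invertible matrix.\<close>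

lemma opening_jacobian_factorization:
  fixes \<iota> :: "'n::finite \<Rightarrow> 'm::finite"
  assumes \<iota>: "inj \<iota>" and op: "opening_via \<iota> a b x f g"
  obtains M where "smooth_germ a M"
    "\<forall>\<^sub>F t in nhds a. jacobian f (at t) = M t ** jacobian g (at t) \<and> inj ((*v) (M t))"
proof -
  define u where "u = (\<lambda>t. x (f t))"
  have f: "smooth_germ a f" "f a = b" and g: "smooth_germ a g" and x: "local_coordinates b x"
    and ug: "\<forall>\<^sub>F t in nhds a. \<forall>i. u t $ \<iota> i = g t $ i"
    and jac: "\<And>j. j \<notin> range \<iota> \<Longrightarrow> differential (\<lambda>t. u t $ j) \<in> jacobi_module a g"
    using op unfolding opening_via_def map_germ_def u_def by blast+
  obtain y where xs: "smooth_germ b x" and y: "\<forall>\<^sub>F p in nhds b. smooth_germ (x p) y \<and> y (x p) = p \<and>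
       jacobian y (at (x p)) ** jacobian x (at p) = mat 1"
    using local_coordinates_inverse[OF x] .
  have u: "smooth_germ a u"
    unfolding u_def using f xs by (simp add: smooth_germ_compose[OF f(1)])
  have "\<forall>j. \<exists>h. j \<notin> range \<iota> \<longrightarrow> (\<forall>k. smooth_germ a (h k)) \<and>
      (\<forall>\<^sub>F t in nhds a. differential (\<lambda>t. u t $ j) t
           = (\<lambda>v. \<Sum>k\<in>UNIV. h k t * differential (\<lambda>s. g s $ k) t v))"
    using jac unfolding jacobi_module_def by blast
  from choice[OF this] obtain h where "\<forall>j. j \<notin> range \<iota> \<longrightarrow> (\<forall>k. smooth_germ a (h j k)) \<and>
      (\<forall>\<^sub>F t in nhds a. differential (\<lambda>t. u t $ j) t
           = (\<lambda>v. \<Sum>k\<in>UNIV. h j k t * differential (\<lambda>s. g s $ k) t v))"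
    by (rule exE)
  then have h: "\<And>j k. j \<notin> range \<iota> \<Longrightarrow> smooth_germ a (h j k)"
      "\<And>j. j \<notin> range \<iota> \<Longrightarrow> \<forall>\<^sub>F t in nhds a. differential (\<lambda>t. u t $ j) t
           = (\<lambda>v. \<Sum>k\<in>UNIV. h j k t * differential (\<lambda>s. g s $ k) t v)"
    by simp_all
  define H :: "real^'n \<Rightarrow> real^'n^'m"
    where "H = (\<lambda>t. \<chi> j. if j \<in> range \<iota> then axis (inv \<iota> j) 1 else (\<chi> k. h j k t))"
  have H_id: "\<forall>i. H t $ \<iota> i = axis i 1" for t
    using \<iota> by (simp add: H_def)
  have "smooth_germ a (\<lambda>t. H t $ j $ k)" for j k
    using h(1)[of j k] by (cases "j \<in> range \<iota>") (simp_all add: H_def smooth_germ_const)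
  then have H: "smooth_germ a H"
    by (simp add: smooth_germ_matrix_iff)
  have "\<forall>\<^sub>F t in nhds a. \<forall>j. j \<notin> range \<iota> \<longrightarrow> differential (\<lambda>t. u t $ j) t
           = (\<lambda>v. \<Sum>k\<in>UNIV. h j k t * differential (\<lambda>s. g s $ k) t v)"
  proof (rule eventually_all_finite)
    fix j
    show "\<forall>\<^sub>F t in nhds a. j \<notin> range \<iota> \<longrightarrow> differential (\<lambda>t. u t $ j) t
           = (\<lambda>v. \<Sum>k\<in>UNIV. h j k t * differential (\<lambda>s. g s $ k) t v)"
      using h(2)[of j] by (cases "j \<in> range \<iota>") simp_all
  qed
  with smooth_germ_eventually[OF u] smooth_germ_eventually[OF g]
    eventually_eventually[THEN iffD2, OF ug]
  have Ju: "\<forall>\<^sub>F t in nhds a. jacobian u (at t) = H t ** jacobian g (at t)"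
  proof eventually_elim
    case (elim t)
    have du: "u differentiable (at t)" and dg: "g differentiable (at t)"
      using elim(1,2) by (simp_all add: smooth_germ_differentiable)
    have "(jacobian u (at t) *v v) $ j = (H t *v (jacobian g (at t) *v v)) $ j" for j v
    proof (cases "j \<in> range \<iota>")
      case True
      then obtain i where j: "j = \<iota> i" by blast
      have "differential (\<lambda>s. u s $ j) t = differential (\<lambda>s. g s $ i) t"
        unfolding differential_def
        unfolding j using elim(3)
        by (intro frechet_derivative_cong_eventually) (rule eventually_mono, assumption, blast)
      then have "(jacobian u (at t) *v v) $ j = (jacobian g (at t) *v v) $ i"
        using differential_component[OF du] differential_component[OF dg] by metis
      then show ?thesis by (simp add: j identity_rows_mult_vec[OF H_id])
    next
      case False
      then show ?thesis
        using elim(4) fun_cong[OF differential_component[OF du, of j], of v]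
        by (simp add: differential_component[OF dg] H_def matrix_vector_mult_def[of "\<chi> j. _ j"])
    qed
    then show ?case
      by (simp add: matrix_eq vec_eq_iff flip: matrix_vector_mul_assoc)
  qed
  define M where "M = (\<lambda>t. jacobian y (at (u t)) ** H t)"
  have ya: "smooth_germ (u a) y"
    using eventually_nhds_x_imp_x[OF y] by (simp add: u_def f(2))
  have M: "smooth_germ a M"
    unfolding M_def
    by (rule smooth_germ_matrix_mult[OF smooth_germ_compose[OF u smooth_germ_jacobian[OF ya]] H])
  have yu: "\<forall>\<^sub>F t in nhds a. smooth_germ (u t) y \<and> y (u t) = f t \<and>
       jacobian y (at (u t)) ** jacobian x (at (f t)) = mat 1"
    using filterlim_iff[THEN iffD1, rule_format, OF smooth_germ_tendsto[OF f(1), unfolded f(2)] y]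
    by (simp add: u_def)
  have "\<forall>\<^sub>F t in nhds a. jacobian f (at t) = M t ** jacobian g (at t) \<and> inj ((*v) (M t))"
    using smooth_germ_eventually[OF u] Ju yu eventually_eventually[THEN iffD2, OF yu]
  proof eventually_elim
    case (elim t)
    have "jacobian f (at t) = jacobian (\<lambda>s. y (u s)) (at t)"
      using elim(4)
      by (intro jacobian_cong_eventually) (rule eventually_mono, assumption, simp)
    also have "\<dots> = jacobian y (at (u t)) ** jacobian u (at t)"
      using elim(1,3) by (intro jacobian_compose smooth_germ_differentiable) simp_all
    finally have "jacobian f (at t) = M t ** jacobian g (at t)"
      by (simp add: elim(2) M_def matrix_mul_assoc)
    moreover have "inj ((*v) (jacobian y (at (u t))))"
      using elim(3) matrix_left_right_inverse matrix_left_invertible_injective by metis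
    then have "inj (\<lambda>v. jacobian y (at (u t)) *v (H t *v v))"
      using inj_compose[OF _ inj_matrix_if_identity_rows[OF H_id[of t]]] by (simp add: o_def)
    then have "inj ((*v) (M t))"
      by (simp add: M_def matrix_vector_mul_assoc)
    ultimately show ?case by blast
  qed
  with M show thesis by (rule that)
qed

section \<open>Frontals in adapted coordinates are openings\<close>

text \<open>The pointwise factor \<open>B\<close> in \<open>J(x \<circ> f) = D ** B\<close> is beyond control where \<open>f\<close> is singular. It
  cancels: adaptedness makes the selected rows \<open>P\<close> of \<open>D\<close> invertible, and these rows express the
  Jacobian of \<open>g\<close> as \<open>P ** B\<close>, so \<open>Q = D ** matrix_inv P\<close> is a smooth matrix with
  \<open>J(x \<circ> f) = Q ** Jg\<close>.\<close>

lemma adapted_frontal_opening_via: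
  fixes \<iota> :: "'n::finite \<Rightarrow> 'm::finite"
  assumes f: "map_germ a b f" and lift: "legendre_lift a f F"
    and x: "local_coordinates b x" and ad: "adapted \<iota> a b F x"
  shows "opening_via \<iota> a b x f (\<lambda>t. \<chi> i. x (f t) $ \<iota> i)"
proof -
  define u where "u = (\<lambda>t. x (f t))"
  define g where "g = (\<lambda>t. \<chi> i. u t $ \<iota> i)"
  have sf: "smooth_germ a f" "f a = b" using f by (simp_all add: map_germ_def)
  obtain y where xs: "smooth_germ b x" and "\<forall>\<^sub>F p in nhds b. smooth_germ (x p) y \<and> y (x p) = p \<and>
       jacobian y (at (x p)) ** jacobian x (at p) = mat 1"
    using local_coordinates_inverse[OF x] .
  then have Jx: "jacobian y (at (x b)) ** jacobian x (at b) = mat 1"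
    by (blast dest: eventually_nhds_x_imp_x)
  have u: "smooth_germ a u"
    unfolding u_def using sf xs by (simp add: smooth_germ_compose[OF sf(1)])
  have g: "smooth_germ a g"
    using u by (simp add: g_def smooth_germ_vec_iff)
  obtain \<kappa> :: "'n \<Rightarrow> 'm" and A where A: "smooth_germ a A"
      "\<forall>\<^sub>F t in nhds a. grassmann_chart \<kappa> (snd (F t)) (A t)"
    using lift unfolding legendre_lift_def smooth_germ_grassmann_bundle_def by blast
  have df: "\<forall>\<^sub>F t in nhds a. range (frechet_derivative f (at t)) \<subseteq> snd (F t)"
    using lift unfolding legendre_lift_def eventually_conj_iff by blast
  define D where "D = (\<lambda>t. jacobian x (at (f t)) ** A t)"
  define P where "P = (\<lambda>t. select_rows \<iota> (D t))"
  have D: "smooth_germ a D"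
    unfolding D_def using smooth_germ_compose[OF sf(1), of "\<lambda>p. jacobian x (at p)"] xs sf(2)
    by (intro smooth_germ_matrix_mult[OF _ A(1)]) (simp add: smooth_germ_jacobian)
  have P: "smooth_germ a P"
    unfolding P_def by (rule smooth_germ_select_rows[OF D])

  have Jx': "jacobian x (at b) ** jacobian y (at (x b)) = mat 1"
    using Jx matrix_left_right_inverse by blast
  have dx: "frechet_derivative x (at b) = (*v) (jacobian x (at b))"
    using frechet_derivative_jacobian[OF smooth_germ_differentiable[OF xs]] .
  have "surj ((*v) (jacobian x (at b)))"
    using Jx' matrix_right_invertible_surjective by blast
  then have coord: "jacobian x (at b) *v coordinate_vector x b j = axis j 1" for j
    unfolding coordinate_vector_def dx by (rule surj_f_inv_f)
  have chart_a: "grassmann_chart \<kappa> (snd (F a)) (A a)"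
    using A(2) by (rule eventually_nhds_x_imp_x)
  \<comment> \<open>Adaptedness: \<open>Jx\<close> maps the plane of the lift at \<open>a\<close> into the span of the axes \<open>\<iota> i\<close>.\<close>
  have D_range: "(D a *v v) $ j = 0" if "j \<notin> range \<iota>" for v j
  proof -
    have "A a *v v \<in> span (range (\<lambda>i. coordinate_vector x b (\<iota> i)))"
      using chart_a ad unfolding grassmann_chart_def adapted_def by auto
    then have "jacobian x (at b) *v (A a *v v) \<in> span ((*v) (jacobian x (at b)) ` range (\<lambda>i. coordinate_vector x b (\<iota> i)))"
      by (simp add: linear_span_image)
    also have "(*v) (jacobian x (at b)) ` range (\<lambda>i. coordinate_vector x b (\<iota> i)) = range (\<lambda>i. axis (\<iota> i) 1)"
      by (simp add: image_image coord)
    finally have "D a *v v \<in> span (range (\<lambda>i. axis (\<iota> i) 1))"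
      by (simp add: D_def sf(2) matrix_vector_mul_assoc)
    also have "\<dots> \<subseteq> {w. w $ j = 0}"
    proof (rule span_minimal)
      show "range (\<lambda>i. axis (\<iota> i) 1) \<subseteq> {w. w $ j = 0}" using that by (auto simp: axis_def)
      show "subspace {w::real^'m. w $ j = 0}" by (simp add: subspace_def)
    qed
    finally show ?thesis by simp
  qed
  \<comment> \<open>The entries of \<open>D a *v v\<close> that \<open>P\<close> does not see vanish, so \<open>P a\<close> inherits injectivity from \<open>D a\<close>.\<close>
  have "inj ((*v) (P a))"
    unfolding inj_matrix_iff
  proof (intro allI impI)
    fix v assume "P a *v v = 0"
    then have "(D a *v v) $ \<iota> i = 0" for i
      by (metis P_def select_rows_mult_vec zero_index)
    with D_range have "D a *v v = 0"
      unfolding vec_eq_iff by (metis rangeE zero_index)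
    then have "jacobian y (at (x b)) *v (jacobian x (at b) *v (A a *v v)) = 0"
      by (simp add: D_def sf(2) flip: matrix_vector_mul_assoc)
    then have "A a *v v = 0"
      by (simp add: matrix_vector_mul_assoc matrix_mul_assoc Jx)
    then show "v = 0"
      using inj_matrix_if_identity_rows chart_a unfolding grassmann_chart_def inj_matrix_iff by blast
  qed
  then have Pa: "invertible (P a)"
    using invertible_left_inverse matrix_left_invertible_injective by blast
  define Q where "Q = (\<lambda>t. D t ** matrix_inv (P t))"
  have Q: "smooth_germ a Q"
    unfolding Q_def by (rule smooth_germ_matrix_mult[OF D smooth_germ_matrix_inv[OF P Pa]])
  have xf: "\<forall>\<^sub>F t in nhds a. smooth_germ (f t) x"
    using filterlim_iff[THEN iffD1, rule_format, OF smooth_germ_tendsto[OF sf(1)]]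
      smooth_germ_eventually[OF xs] sf(2) by blast
  have "\<forall>\<^sub>F t in nhds a. jacobian u (at t) = Q t ** jacobian g (at t)
      \<and> u differentiable (at t) \<and> g differentiable (at t)"
    using smooth_germ_eventually[OF sf(1)] smooth_germ_eventually[OF u] smooth_germ_eventually[OF g]
      xf A(2) df invertible_eventually[OF P Pa]
  proof eventually_elim
    case (elim t)
    note diff = elim(1-4)[THEN smooth_germ_differentiable]
    have "range ((*v) (jacobian f (at t))) \<subseteq> range ((*v) (A t))"
      using elim(5,6) frechet_derivative_jacobian[OF diff(1)] by (simp add: grassmann_chart_def)
    then obtain B where B: "jacobian f (at t) = A t ** B"
      by (rule matrix_factor_if_range_subset)
    have Ju: "jacobian u (at t) = D t ** B"
      unfolding u_def D_def using jacobian_compose[OF diff(1,4)] B by (simp add: matrix_mul_assoc)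
    have "(jacobian g (at t) *v v) $ i = (select_rows \<iota> (jacobian u (at t)) *v v) $ i" for v i
      using differential_component[OF diff(2), of "\<iota> i"] differential_component[OF diff(3), of i]
      by (simp add: g_def select_rows_mult_vec fun_eq_iff)
    then have "jacobian g (at t) = select_rows \<iota> (jacobian u (at t))"
      by (simp add: matrix_eq vec_eq_iff)
    then have Jg: "jacobian g (at t) = P t ** B"
      by (simp add: Ju P_def select_rows_mult)
    have "Q t ** jacobian g (at t) = D t ** ((matrix_inv (P t) ** P t) ** B)"
      by (simp add: Q_def Jg matrix_mul_assoc)
    then have "jacobian u (at t) = Q t ** jacobian g (at t)"
      by (simp add: Ju invertible_matrix_inv(2)[OF elim(7)])
    then show ?case using diff by blast
  qed
  then have "\<forall>\<^sub>F t in nhds a. differential (\<lambda>t. u t $ j) t =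
      (\<lambda>v. \<Sum>k\<in>UNIV. Q t $ j $ k * differential (\<lambda>s. g s $ k) t v)" for j
  proof eventually_elim
    case (elim t)
    then have "differential (\<lambda>t. u t $ j) t = (\<lambda>v. (Q t *v (jacobian g (at t) *v v)) $ j)"
      using differential_component[of u t j] by (simp add: matrix_vector_mul_assoc)
    then show ?case
      using elim by (simp add: differential_component matrix_vector_mult_def[of "Q t"])
  qed
  then have "differential (\<lambda>t. u t $ j) \<in> jacobi_module a g" for j
    using Q unfolding jacobi_module_def smooth_germ_matrix_iff
    by (auto intro!: exI[of _ "\<lambda>k t. Q t $ j $ k"])
  then show ?thesis
    using f g x unfolding opening_via_def u_def g_def by simp
qed

section \<open>Properness\<close>

lemma nowhere_dense_germ_cong:
  assumes "\<forall>\<^sub>F t in nhds a. t \<in> S \<longleftrightarrow> t \<in> T" "nowhere_dense_germ a S"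
  shows "nowhere_dense_germ a T"
proof -
  obtain U where U: "open U" "a \<in> U" "interior (closure (S \<inter> U)) = {}"
    using assms(2) unfolding nowhere_dense_germ_def by blast
  obtain V where V: "open V" "a \<in> V" "\<And>t. t \<in> V \<Longrightarrow> t \<in> S \<longleftrightarrow> t \<in> T"
    using assms(1) unfolding eventually_nhds by blast
  have "interior (closure (T \<inter> (U \<inter> V))) \<subseteq> interior (closure (S \<inter> U))"
    by (intro interior_mono closure_mono) (use V(3) in blast)
  then show ?thesis
    using U V unfolding nowhere_dense_germ_def by (intro exI[of _ "U \<inter> V"]) auto
qed

lemma singular_locus_iff: "t \<in> singular_locus f \<longleftrightarrow> \<not> inj ((*v) (jacobian f (at t)))"
  by (simp add: singular_locus_def less_rank_noninjective)

text \<open>An injective left factor preserves the kernel, so \<open>f\<close> and \<open>g\<close> have the same singular points near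
  \<open>a\<close>.\<close>

lemma proper_germ_iff_if_jacobian_factors:
  fixes f :: "real^'n::finite \<Rightarrow> real^'m::finite" and g :: "real^'n \<Rightarrow> real^'k::finite"
  assumes "\<forall>\<^sub>F t in nhds a. jacobian f (at t) = M t ** jacobian g (at t) \<and> inj ((*v) (M t))"
  shows "proper_germ a f \<longleftrightarrow> proper_germ a g"
proof -
  have "\<forall>\<^sub>F t in nhds a. t \<in> singular_locus f \<longleftrightarrow> t \<in> singular_locus g"
    using assms
  proof eventually_elim
    case (elim t)
    then have "inj ((*v) (jacobian f (at t))) \<longleftrightarrow> inj ((*v) (jacobian g (at t)))"
      unfolding inj_matrix_iff by (metis matrix_vector_mul_assoc matrix_vector_mult_0_right)
    then show ?case by (simp add: singular_locus_iff)
  qed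
  then show ?thesis
    unfolding proper_germ_def using nowhere_dense_germ_cong[where a = a] by (metis (mono_tags, lifting) eventually_mono)
qed

theorem lemma4p3:
  fixes \<iota> :: "'n::finite \<Rightarrow> 'm::finite"
  assumes "inj \<iota>"
  shows
    "(\<forall>(a :: real^'n) (b :: real^'m) f F x.
        frontal a b f \<and> legendre_lift a f F \<and> centered_coordinates b x \<and> adapted \<iota> a b F x \<longrightarrow>
        opening_via \<iota> a b x f (\<lambda>t. \<chi> i. x (f t) $ \<iota> i)) \<and>
     (\<forall>(a :: real^'n) (b :: real^'m) f g.
        is_opening \<iota> a b f g \<longrightarrow> frontal a b f) \<and>
     (\<forall>(a :: real^'n) (b :: real^'m) f g.
        is_opening \<iota> a b f g \<longrightarrow> (proper_frontal a b f \<longleftrightarrow> proper_germ a g))"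
proof -
  have "frontal a b f \<and> (proper_germ a f \<longleftrightarrow> proper_germ a g)" if op: "is_opening \<iota> a b f g"
    for a :: "real^'n" and b :: "real^'m" and f g
  proof -
    obtain x where x: "opening_via \<iota> a b x f g"
      using op unfolding is_opening_def by blast
    obtain M where M: "smooth_germ a M"
      "\<forall>\<^sub>F t in nhds a. jacobian f (at t) = M t ** jacobian g (at t) \<and> inj ((*v) (M t))"
      using opening_jacobian_factorization[OF assms x] .
    have "frontal a b f"
    proof (rule frontal_if_jacobian_factors)
      show "map_germ a b f" using x by (simp add: opening_via_def)
      show "inj ((*v) (M a))" using eventually_nhds_x_imp_x[OF M(2)] by blast
      show "\<forall>\<^sub>F t in nhds a. \<exists>B. jacobian f (at t) = M t ** B"
        using M(2) by eventually_elim blast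
    qed (rule M(1))
    with proper_germ_iff_if_jacobian_factors[OF M(2)] show ?thesis by blast
  qed
  moreover have "opening_via \<iota> a b x f (\<lambda>t. \<chi> i. x (f t) $ \<iota> i)"
    if "frontal a b f \<and> legendre_lift a f F \<and> centered_coordinates b x \<and> adapted \<iota> a b F x"
    for a :: "real^'n" and b :: "real^'m" and f F x
    by (rule adapted_frontal_opening_via[of a b f F])
      (use that in \<open>simp_all add: frontal_def centered_coordinates_def\<close>)
  ultimately show ?thesis
    unfolding proper_frontal_def by blast
qed

end
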